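(* Let $q$ be an odd prime power and $m\ge2$ an integer with $m\mid q+1$. For the subgraph of $\mathrm{GP}(q^2,m)$ induced by $Q$ the following hold. (1) Assume $m\mid\frac{q+1}{2}$. Then for any $0\le i_1<i_2\le m-1$, all possible edges are present between $Q_{i_1}$ and $Q_{i_2}$ if $i_1+i_2\equiv0\pmod m$, and there are no edges between them otherwise. (1.1) If moreover $m$ is odd, then $Q_0$ is a clique and $Q_1,\dots,Q_{m-1}$ are independent sets; in particular $Q_1\cup Q_{m-1},\dots,Q_{\frac{m-1}{2}}\cup Q_{\frac{m+1}{2}}$ induce $\frac{m-1}{2}$ complete bipartite graphs. (1.2) If moreover $m$ is even, then $Q_0$ and $Q_{m/2}$ are cliques and $Q_1,\dots,Q_{\frac m2-1},Q_{\frac m2+1},\dots,Q_{m-1}$ are independent sets; in particular, if $m\ge4$, then $Q_1\cup Q_{m-1},\dots,Q_{\frac m2-1}\cup Q_{\frac m2+1}$ induce $\frac m2-1$ complete bipartite graphs. (2) Assume $m\nmid\frac{q+1}{2}$. Then $m$ is even, and for any $0\le i_1<i_2\le m-1$, all possible edges are present between $Q_{i_1}$ and $Q_{i_2}$ if $i_1+i_2\equiv\frac m2\pmod m$, and there are no edges between them otherwise. (2.1) If moreover $\frac m2$ is odd, then $Q_0,\dots,Q_{m-1}$ are independent sets; in particular, if $m=2$ then $Q=Q_0\cup Q_1$ induces a complete bipartite graph, and if $m\ge6$ then $Q_0\cup Q_{\frac m2},\dots,Q_{\frac{m-2}{4}}\cup Q_{\frac{m+2}{4}},Q_{\frac m2+1}\cup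 Q_{m-1},\dots,Q_{\frac{3m-2}{4}}\cup Q_{\frac{3m+2}{4}}$ induce $\frac m2$ complete bipartite graphs. (2.2) If moreover $\frac m2$ is even, then $Q_{m/4}$ and $Q_{3m/4}$ are cliques and all other $Q_i$ ($0\le i\le m-1$, $i\ne\frac m4,\frac{3m}4$) are independent sets; in particular, if $m=4$ then $Q_0\cup Q_2$ induces a complete bipartite graph, and if $m\ge8$ then $Q_0\cup Q_{\frac m2},\dots,Q_{\frac{m-4}{4}}\cup Q_{\frac{m+4}{4}},Q_{\frac m2+1}\cup Q_{m-1},\dots,Q_{\frac{3m-4}{4}}\cup Q_{\frac{3m+4}{4}}$ induce $\frac{m-2}{2}$ complete bipartite graphs.
   Context: The generalised Paley graph $\mathrm{GP}(q^2,m)$ has vertex set $\mathbb{F}_{q^2}$, with two distinct vertices $x,y$ adjacent iff $x-y$ is an $m$-th power of an element of $\mathbb{F}_{q^2}^*$. Fix a primitive element $\beta$ of $\mathbb{F}_{q^2}$, let $\omega=\beta^{q-1}$, $Q=\langle\omega\rangle$ (subgroup of order $q+1$ of $\mathbb{F}_{q^2}^*$), $Q_0=\langle\omega^m\rangle$, and $Q_i=\omega^iQ_0$ for $0\le i\le m-1$. *)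

theory Defs
  imports
    "HOL-Library.Cardinality"
    "HOL-Number_Theory.Cong"
    "HOL-Number_Theory.Prime_Powers"
    "Graph_Theory.Graph_Theory"
begin

definition cyclic_subgroup :: "'a::field \<Rightarrow> 'a set" where
  "cyclic_subgroup g = {g powi k | k :: int. True}"

definition primitive_elem :: "'a::field \<Rightarrow> bool" where
  "primitive_elem \<beta> \<longleftrightarrow> \<beta> \<noteq> 0 \<and> cyclic_subgroup \<beta> = UNIV - {0}"

text \<open>The field is the whole type, so the generalised Paley graph on the field with
  \<open>q\<^sup>2\<close> elements is \<open>gen_paley m\<close> at a type \<open>'a\<close> with \<open>CARD('a) = q\<^sup>2\<close>. As usual in
  \<^theory>\<open>Graph_Theory.Digraph\<close>, an undirected edge is a pair of opposite arcs; both arcs are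
  present when \<open>-1\<close> is an \<open>m\<close>-th power, which holds for odd \<open>q\<close> and \<open>m dvd q + 1\<close>.\<close>

definition gen_paley :: "nat \<Rightarrow> ('a::field, 'a \<times> 'a) pre_digraph" where
  "gen_paley m =
     \<lparr>verts = UNIV, arcs = {(x, y). x \<noteq> y \<and> (\<exists>z. z \<noteq> 0 \<and> x - y = z ^ m)},
      tail = fst, head = snd\<rparr>"

definition clique :: "('a, 'b) pre_digraph \<Rightarrow> 'a set \<Rightarrow> bool" where
  "clique G S \<longleftrightarrow> S \<subseteq> verts G \<and> (\<forall>u\<in>S. \<forall>v\<in>S. u \<noteq> v \<longrightarrow> u \<rightarrow>\<^bsub>G\<^esub> v)"

definition independent_set :: "('a, 'b) pre_digraph \<Rightarrow> 'a set \<Rightarrow> bool" where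
  "independent_set G S \<longleftrightarrow> S \<subseteq> verts G \<and> (\<forall>u\<in>S. \<forall>v\<in>S. \<not> u \<rightarrow>\<^bsub>G\<^esub> v)"

definition all_edges_between :: "('a, 'b) pre_digraph \<Rightarrow> 'a set \<Rightarrow> 'a set \<Rightarrow> bool" where
  "all_edges_between G U V \<longleftrightarrow> (\<forall>u\<in>U. \<forall>v\<in>V. u \<rightarrow>\<^bsub>G\<^esub> v \<and> v \<rightarrow>\<^bsub>G\<^esub> u)"

definition no_edges_between :: "('a, 'b) pre_digraph \<Rightarrow> 'a set \<Rightarrow> 'a set \<Rightarrow> bool" where
  "no_edges_between G U V \<longleftrightarrow> (\<forall>u\<in>U. \<forall>v\<in>V. \<not> u \<rightarrow>\<^bsub>G\<^esub> v \<and> \<not> v \<rightarrow>\<^bsub>G\<^esub> u)"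

definition induces_complete_bipartite :: "('a, 'b) pre_digraph \<Rightarrow> 'a set \<Rightarrow> 'a set \<Rightarrow> bool" where
  "induces_complete_bipartite G U V \<longleftrightarrow>
     U \<union> V \<subseteq> verts G \<and> complete_bipartite_digraph (card U) (card V) (G \<restriction> (U \<union> V))"

text \<open>\<open>P\<close> is a set of index pairs \<open>(i, j)\<close>. The sets \<open>Q i \<union> Q j\<close> are required to be \<open>n\<close>
  different sets, each inducing a complete bipartite graph.\<close>

definition induce_complete_bipartite_graphs ::
  "('a, 'b) pre_digraph \<Rightarrow> (nat \<Rightarrow> 'a set) \<Rightarrow> (nat \<times> nat) set \<Rightarrow> nat \<Rightarrow> bool" where
  "induce_complete_bipartite_graphs G Q P n \<longleftrightarrow>
     card {Q i \<union> Q j | i j. (i, j) \<in> P} = n \<and>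
     (\<forall>(i, j)\<in>P. induces_complete_bipartite G (Q i) (Q j))"

end

theory Submission
  imports Defs "HOL-Number_Theory.Residues"
begin

text \<open>Write \<open>u = \<omega>\<^sup>a\<close> and \<open>v = \<omega>\<^sup>b\<close> for two different elements of \<open>Q\<close> and \<open>u - v = \<beta>\<^sup>k\<close>. The
  Frobenius map \<open>x \<mapsto> x\<^sup>q\<close> inverts every element of \<open>Q\<close>, so
  \<open>(u - v)\<^sup>q = 1/u - 1/v = - (u - v)/(u v)\<close>, which reads \<open>\<omega>\<^sup>k = - \<omega>\<^sup>-\<^sup>(\<^sup>a\<^sup>+\<^sup>b\<^sup>)\<close>. As
  \<open>-1 = \<omega>\<^sup>h\<close> with \<open>h = (q + 1)/2\<close>, this means \<open>k \<equiv> h - (a + b) (mod q + 1)\<close>, and \<open>u - v\<close> is an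
  \<open>m\<close>-th power iff \<open>a + b \<equiv> h (mod m)\<close>. Everything else is arithmetic of residues modulo \<open>m\<close>,
  where \<open>h \<equiv> 0\<close> or \<open>h \<equiv> m/2\<close>.\<close>

section \<open>Powers of primitive elements\<close>

text \<open>Multiplication by \<open>x\<close> permutes the nonzero elements. Their product is thus
  unchanged, yet it acquires one factor \<open>x\<close> per element, and the nonzero product
  cancels.\<close>

lemma finite_field_power_card_minus_1:
  fixes x :: "'a :: {field, finite}"
  assumes "x \<noteq> 0"
  shows "x ^ (CARD('a) - 1) = 1"
proof -
  have "(\<Prod>y\<in>UNIV - {0}. y) = (\<Prod>y\<in>UNIV - {0}. x * y)"
    by (rule prod.reindex_bij_witness[of _ "\<lambda>y. x * y" "\<lambda>y. y / x"]) (use assms in auto)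
  also have "\<dots> = x ^ (CARD('a) - 1) * (\<Prod>y\<in>UNIV - {0}. y)"
    by (simp add: prod.distrib)
  finally show ?thesis by simp
qed

text \<open>Exponents may be reduced modulo any positive \<open>d\<close> with
  \<open>g ^ d = 1\<close>. Since \<open>d\<close> may be a multiple of the order, this serves as an
  upper bound on the size of the subgroup.\<close>

lemma cyclic_subgroup_eq_image:
  assumes "g ^ d = 1" and "d > 0"
  shows "cyclic_subgroup g = (\<lambda>k. g ^ k) ` {..<d}"
proof
  have "g \<noteq> 0" using assms by (auto simp: power_0_left)
  show "cyclic_subgroup g \<subseteq> (\<lambda>k. g ^ k) ` {..<d}"
  proof
    fix x assume "x \<in> cyclic_subgroup g"
    then obtain k where "x = g powi k" by (auto simp: cyclic_subgroup_def)
    also have "\<dots> = g powi (int d * (k div int d) + k mod int d)" by simp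
    also have "\<dots> = (g powi int d) powi (k div int d) * g powi (k mod int d)"
      using \<open>g \<noteq> 0\<close> by (subst power_int_add) (simp_all only: power_int_mult, simp)
    also have "\<dots> = g ^ nat (k mod int d)"
      using assms by (simp add: power_int_nonneg_exp)
    finally show "x \<in> (\<lambda>k. g ^ k) ` {..<d}"
      using assms(2) by (intro image_eqI[of _ _ "nat (k mod int d)"]) (auto simp: nat_less_iff)
  qed
  show "(\<lambda>k. g ^ k) ` {..<d} \<subseteq> cyclic_subgroup g"
    unfolding cyclic_subgroup_def by (auto intro!: exI[of _ "int _"])
qed

lemma cyclic_subgroup_eq_range:
  assumes "g ^ d = 1" and "d > 0"
  shows "cyclic_subgroup g = range (\<lambda>k. g ^ k)"
proof
  show "cyclic_subgroup g \<subseteq> range (\<lambda>k. g ^ k)"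
    unfolding cyclic_subgroup_eq_image[OF assms] by blast
  show "range (\<lambda>k. g ^ k) \<subseteq> cyclic_subgroup g"
    unfolding cyclic_subgroup_def by (auto intro!: exI[of _ "int _"])
qed

text \<open>If \<open>CARD('a) - 1\<close> did not divide \<open>n\<close>, the positive remainder
  \<open>r\<close> would satisfy \<open>\<beta> ^ r = 1\<close>. The subgroup would then have at
  most \<open>r\<close> elements, too few to contain every nonzero element.\<close>

lemma primitive_elem_power_eq_1_iff:
  fixes \<beta> :: "'a :: {field, finite}"
  assumes "primitive_elem \<beta>"
  shows "\<beta> ^ n = 1 \<longleftrightarrow> CARD('a) - 1 dvd n"
proof
  let ?N = "CARD('a) - 1"
  have \<beta>: "\<beta> \<noteq> 0" "cyclic_subgroup \<beta> = UNIV - {0}" using assms by (auto simp: primitive_elem_def)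
  have one: "\<beta> ^ ?N = 1" using \<beta>(1) by (rule finite_field_power_card_minus_1)
  have "CARD('a) \<ge> card {0, 1 :: 'a}" by (rule card_mono) auto
  then have N: "?N > 0" by simp
  show "\<beta> ^ n = 1" if "?N dvd n" using that one by (auto elim!: dvdE simp: power_mult)
  show "?N dvd n" if "\<beta> ^ n = 1"
  proof (rule ccontr)
    assume "\<not> ?N dvd n"
    then have r: "n mod ?N > 0" by (simp add: mod_greater_zero_iff_not_dvd)
    have "\<beta> ^ n = (\<beta> ^ ?N) ^ (n div ?N) * \<beta> ^ (n mod ?N)"
      by (simp flip: power_mult power_add)
    then have "\<beta> ^ (n mod ?N) = 1" using that one by simp
    then have "card (cyclic_subgroup \<beta>) \<le> card {..<n mod ?N}"
      using r by (simp add: cyclic_subgroup_eq_image card_image_le del: card_lessThan)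
    moreover have "card (cyclic_subgroup \<beta>) = ?N" by (simp add: \<beta>(2) card_Diff_singleton)
    moreover have "n mod ?N < ?N" using N by simp
    ultimately show False by simp
  qed
qed

lemma power_eq_power_iff_cong:
  fixes g :: "'a :: field"
  assumes "g \<noteq> 0" and "\<And>n. g ^ n = 1 \<longleftrightarrow> d dvd n"
  shows "g ^ i = g ^ j \<longleftrightarrow> [i = j] (mod d)"
proof (induction i j rule: linorder_wlog)
  case (le i j)
  then have "g ^ i = g ^ j \<longleftrightarrow> g ^ (j - i) = 1"
    using assms(1) by (auto simp: power_diff)
  also have "\<dots> \<longleftrightarrow> [i = j] (mod d)"
    using le by (simp add: assms(2) cong_altdef_nat cong_sym_eq[of i j])
  finally show ?case .
qed (auto simp: cong_sym_eq eq_commute)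

lemma primitive_elemE:
  fixes \<beta> x :: "'a :: {field, finite}"
  assumes "primitive_elem \<beta>" and "x \<noteq> 0"
  obtains k where "x = \<beta> ^ k"
proof -
  have "CARD('a) \<ge> card {0, 1 :: 'a}" by (rule card_mono) auto
  moreover have "x \<in> cyclic_subgroup \<beta>" and "\<beta> \<noteq> 0"
    using assms by (auto simp: primitive_elem_def)
  ultimately show ?thesis
    using that cyclic_subgroup_eq_range[OF finite_field_power_card_minus_1, of \<beta>] by auto
qed

text \<open>The characteristic divides the prime power \<open>q ^ 2\<close>, so \<open>q\<close> is
  a power of the characteristic and \<open>x \<mapsto> x ^ q\<close> is additive. Oddness of
  \<open>q\<close> carries the sign through.\<close>

lemma frobenius_diff:
  fixes x y :: "'a :: {field, finite}"
  assumes "primepow q" and "odd q" and "CARD('a) = q ^ 2"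
  shows "(x - y) ^ q = x ^ q - y ^ q"
proof -
  obtain p n where p: "prime p" "q = p ^ n" using assms(1) by (auto simp: primepow_def)
  have "CHAR('a) > 0" by (rule finite_imp_CHAR_pos) simp
  then have char: "prime CHAR('a)" by (rule prime_CHAR_semidom)
  have "CHAR('a) dvd p ^ (n * 2)"
    using CHAR_dvd_CARD[where ?'a = 'a] by (simp add: assms(3) p(2) power_mult)
  then have "CHAR('a) = p"
    using char p(1) by (metis prime_dvd_power primes_dvd_imp_eq)
  then have "(x + - y) ^ q = x ^ q + (- y) ^ q"
    using char p(2) by (intro freshmans_dream') auto
  then show ?thesis using assms(2) by simp
qed

section \<open>Adjacency in the subgroup of order \<open>q + 1\<close>\<close>

locale paley_subgroup =
  fixes q m :: nat and \<beta> :: "'a :: {field, finite}"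
  assumes primepow: "primepow q" and odd_q: "odd q" and m_ge_2: "m \<ge> 2"
    and m_dvd: "m dvd q + 1" and card_field: "CARD('a) = q ^ 2"
    and primitive: "primitive_elem \<beta>"
begin

definition \<omega> :: 'a where
  "\<omega> = \<beta> ^ (q - 1)"

text \<open>This is Q_i. The index ranges over all naturals, so the sets repeat with period
  \<open>m\<close>.\<close>

definition coset :: "nat \<Rightarrow> 'a set" where
  "coset i = (\<lambda>x. \<omega> ^ i * x) ` cyclic_subgroup (\<omega> ^ m)"

lemma q_ge_3: "q \<ge> 3"
  using odd_q primepow_gt_Suc_0[OF primepow] by (cases "q = 2") auto

lemma card_minus_1: "CARD('a) - 1 = (q - 1) * (q + 1)"
  by (simp add: card_field power2_eq_square algebra_simps)

lemma primitive_nonzero: "\<beta> \<noteq> 0"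
  using primitive by (simp add: primitive_elem_def)

lemma omega_nonzero: "\<omega> \<noteq> 0"
  using primitive_nonzero by (simp add: \<omega>_def)

text \<open>The order of \<open>\<beta>\<close> is \<open>(q - 1) * (q + 1)\<close>, and the
  positive factor \<open>q - 1\<close> cancels.\<close>

lemma omega_power_eq_1_iff: "\<omega> ^ n = 1 \<longleftrightarrow> q + 1 dvd n"
  using q_ge_3 unfolding \<omega>_def power_mult[symmetric] primitive_elem_power_eq_1_iff[OF primitive]
    card_minus_1 by (intro nat_mult_dvd_cancel1) simp

lemma primitive_power_eq_iff: "\<beta> ^ i = \<beta> ^ j \<longleftrightarrow> [i = j] (mod ((q - 1) * (q + 1)))"
  using power_eq_power_iff_cong[OF primitive_nonzero primitive_elem_power_eq_1_iff[OF primitive]]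
  unfolding card_minus_1 .

lemma omega_power_eq_iff: "\<omega> ^ i = \<omega> ^ j \<longleftrightarrow> [i = j] (mod (q + 1))"
  using omega_nonzero omega_power_eq_1_iff by (rule power_eq_power_iff_cong)

text \<open>Because \<open>m\<close> divides the order of \<open>\<omega>\<close>, an element of Q
  determines its exponent modulo \<open>m\<close>. This makes the sets Q_i disjoint and lets
  adjacency be read off from indices.\<close>

lemma cong_if_omega_power_eq:
  assumes "\<omega> ^ i = \<omega> ^ j"
  shows "[i = j] (mod m)"
  using assms m_dvd unfolding omega_power_eq_iff by (rule cong_dvd_modulus_nat)

text \<open>The exponent is positive and below the order \<open>q + 1\<close>, and its double is the
  order, so the power is a square root of 1 other than 1.\<close>

lemma omega_power_half: "\<omega> ^ ((q + 1) div 2) = -1"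
proof -
  have "\<omega> ^ ((q + 1) div 2) \<noteq> 1"
    unfolding omega_power_eq_1_iff using q_ge_3 by (auto dest: dvd_imp_le)
  moreover have "(\<omega> ^ ((q + 1) div 2)) ^ 2 = 1"
    using odd_q unfolding power_mult[symmetric] omega_power_eq_1_iff
    by (subst dvd_div_mult_self) auto
  ultimately show ?thesis by (simp add: power2_eq_1_iff)
qed

lemma cyclic_subgroup_omega: "cyclic_subgroup \<omega> = range (\<lambda>a. \<omega> ^ a)"
  by (rule cyclic_subgroup_eq_range[of _ "q + 1"]) (simp_all only: omega_power_eq_1_iff, simp_all)

lemma coset_eq: "coset i = {\<omega> ^ a |a. [a = i] (mod m)}"
proof -
  have "(\<omega> ^ m) ^ (q + 1) = 1"
    unfolding power_mult[symmetric] omega_power_eq_1_iff by (rule dvd_triv_right)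
  then have "cyclic_subgroup (\<omega> ^ m) = range (\<lambda>k. (\<omega> ^ m) ^ k)"
    by (rule cyclic_subgroup_eq_range) simp
  then have coset: "coset i = range (\<lambda>k. \<omega> ^ (i + m * k))"
    by (auto simp: coset_def power_add power_mult image_iff)
  show ?thesis
  proof
    show "coset i \<subseteq> {\<omega> ^ a |a. [a = i] (mod m)}"
      unfolding coset by (auto intro!: exI[of _ "i + m * _"] simp: cong_def)
    show "{\<omega> ^ a |a. [a = i] (mod m)} \<subseteq> coset i"
    proof clarify
      fix a assume "[a = i] (mod m)"
      \<comment> \<open>Adding \<open>(q + 1) * i\<close> does not change the power of
        \<open>\<omega>\<close>, and it makes the exponent at least \<open>i\<close>, so that it
        exceeds \<open>i\<close> by a natural multiple of \<open>m\<close>.\<close>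
      then have "[a + (q + 1) * i = i + 0] (mod m)"
        using dvd_mult2[OF m_dvd] by (intro cong_add) (simp_all only: cong_0_iff)
      then obtain k where "a + (q + 1) * i = i + m * k"
        using cong_le_nat[of i "a + (q + 1) * i" m] by (auto simp: cong_sym_eq mult.commute)
      moreover have "\<omega> ^ a = \<omega> ^ (a + (q + 1) * i)"
        unfolding omega_power_eq_iff cong_def by (rule mod_mult_self2[symmetric])
      ultimately show "\<omega> ^ a \<in> coset i"
        unfolding coset by (metis rangeI)
    qed
  qed
qed

lemma coset_subset: "coset i \<subseteq> cyclic_subgroup \<omega>"
  unfolding coset_eq cyclic_subgroup_omega by auto

lemma coset_nonempty: "coset i \<noteq> {}"
  unfolding coset_eq using cong_refl by blast

lemma coset_inter_cong:
  assumes "x \<in> coset i" and "x \<in> coset j"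
  shows "[i = j] (mod m)"
proof -
  obtain a b where a: "x = \<omega> ^ a" "[a = i] (mod m)" and b: "x = \<omega> ^ b" "[b = j] (mod m)"
    using assms unfolding coset_eq by blast
  have "[i = a] (mod m)" using a(2) by (rule cong_sym)
  also have "[a = b] (mod m)" using a(1) b(1) by (intro cong_if_omega_power_eq) simp
  also have "[b = j] (mod m)" by fact
  finally show ?thesis .
qed

lemma m_dvd_card_minus_1: "m dvd (q - 1) * (q + 1)"
  using m_dvd by (rule dvd_mult)

text \<open>Any \<open>z\<close> is itself a power of \<open>\<beta>\<close>, and since
  \<open>m\<close> divides the order of \<open>\<beta>\<close>, equal powers have exponents
  congruent modulo \<open>m\<close>.\<close>

lemma power_is_mth_power_iff: "(\<exists>z. z \<noteq> 0 \<and> \<beta> ^ k = z ^ m) \<longleftrightarrow> m dvd k"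
proof
  assume "m dvd k"
  then obtain l where "\<beta> ^ k = (\<beta> ^ l) ^ m"
    by (metis dvdE mult.commute power_mult)
  moreover have "\<beta> ^ l \<noteq> 0" using primitive_nonzero by simp
  ultimately show "\<exists>z. z \<noteq> 0 \<and> \<beta> ^ k = z ^ m" by blast
next
  assume "\<exists>z. z \<noteq> 0 \<and> \<beta> ^ k = z ^ m"
  then obtain z where z: "z \<noteq> 0" "\<beta> ^ k = z ^ m" by blast
  obtain l where "z = \<beta> ^ l" using primitive_elemE[OF primitive z(1)] .
  then have "\<beta> ^ k = \<beta> ^ (l * m)" using z(2) by (simp add: power_mult)
  then have "[k = l * m] (mod m)"
    unfolding primitive_power_eq_iff using m_dvd_card_minus_1 by (rule cong_dvd_modulus_nat)
  then show "m dvd k" by (simp add: cong_dvd_iff)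
qed

lemma adjacent_iff:
  assumes "u \<in> coset i" and "v \<in> coset j"
  shows "u \<rightarrow>\<^bsub>gen_paley m \<restriction> cyclic_subgroup \<omega>\<^esub> v \<longleftrightarrow> u \<noteq> v \<and> [i + j = (q + 1) div 2] (mod m)"
proof (cases "u = v")
  case False
  obtain a b where a: "u = \<omega> ^ a" "[a = i] (mod m)" and b: "v = \<omega> ^ b" "[b = j] (mod m)"
    using assms unfolding coset_eq by blast
  obtain k where k: "u - v = \<beta> ^ k"
    using False primitive_elemE[OF primitive, of "u - v"] by auto
  have inverse: "u ^ q * u = 1" "v ^ q * v = 1"
  proof -
    have "(\<omega> ^ n) ^ q * \<omega> ^ n = \<omega> ^ (n * (q + 1))" for n
      by (simp add: power_add power_mult mult.commute)
    also have "\<omega> ^ (n * (q + 1)) = 1" for n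
      unfolding omega_power_eq_1_iff by (rule dvd_triv_right)
    finally show "u ^ q * u = 1" "v ^ q * v = 1"
      unfolding a b by this+
  qed
  \<comment> \<open>Multiplying by \<open>u * v\<close> keeps the computation free of inverses. The
    factor \<open>\<omega> ^ k\<close> is the \<open>(q - 1)\<close>-th power of
    \<open>u - v\<close>, and the extra factor \<open>u - v\<close> completes it to a
    \<open>q\<close>-th power and is cancelled at the end.\<close>
  have "\<omega> ^ k * \<omega> ^ (a + b) * (u - v) = (u - v) ^ (q - 1) * (u - v) * (u * v)"
    unfolding k by (simp add: \<omega>_def a b power_add mult_ac flip: power_mult)
  also have "(u - v) ^ (q - 1) * (u - v) = (u - v) ^ q"
    using q_ge_3 by (simp flip: power_Suc2)
  also have "\<dots> = u ^ q - v ^ q"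
    by (rule frobenius_diff[OF primepow odd_q card_field])
  also have "\<dots> * (u * v) = (u ^ q * u) * v - (v ^ q * v) * u"
    by (simp add: algebra_simps)
  also have "\<dots> = \<omega> ^ ((q + 1) div 2) * (u - v)"
    unfolding inverse omega_power_half by simp
  finally have "\<omega> ^ (k + (a + b)) = \<omega> ^ ((q + 1) div 2)"
    using False by (simp add: power_add)
  then have "[k + (a + b) = (q + 1) div 2] (mod m)"
    by (rule cong_if_omega_power_eq)
  then have sum: "[k + (i + j) = (q + 1) div 2] (mod m)"
    using cong_add[OF cong_refl[of k] cong_add[OF a(2) b(2)]]
    by (rule cong_trans[OF cong_sym, rotated])
  have "u \<rightarrow>\<^bsub>gen_paley m \<restriction> cyclic_subgroup \<omega>\<^esub> v \<longleftrightarrow> (\<exists>z. z \<noteq> 0 \<and> \<beta> ^ k = z ^ m)"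
    using False coset_subset assms k by (auto simp: arcs_ends_conv gen_paley_def)
  also have "\<dots> \<longleftrightarrow> [k = 0] (mod m)"
    by (simp add: power_is_mth_power_iff cong_0_iff)
  also have "\<dots> \<longleftrightarrow> [i + j = (q + 1) div 2] (mod m)"
  proof
    show "[i + j = (q + 1) div 2] (mod m)" if "[k = 0] (mod m)"
      using cong_trans[OF cong_sym[OF cong_add[OF that cong_refl[of "i + j"]]] sum] by simp
    show "[k = 0] (mod m)" if "[i + j = (q + 1) div 2] (mod m)"
      using cong_trans[OF sum cong_sym[OF that]]
        cong_add_rcancel_nat[of k "i + j" 0 m] by simp
  qed
  finally show ?thesis using False by simp
qed (auto simp: arcs_ends_conv gen_paley_def)

lemma digraph_induced: "digraph (gen_paley m \<restriction> cyclic_subgroup \<omega>)"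
  by unfold_locales (auto simp: gen_paley_def arc_to_ends_def)

end

section \<open>Graphs governed by a congruence\<close>

text \<open>Independence removes the arcs inside each side, so the arcs that remain are exactly
  those of \<open>U \<times> V\<close> and \<open>V \<times> U\<close>.\<close>

lemma induces_complete_bipartiteI:
  assumes "digraph G" and "U \<subseteq> verts G" and "V \<subseteq> verts G" and "U \<inter> V = {}"
    and "independent_set G U" and "independent_set G V" and "all_edges_between G U V"
  shows "induces_complete_bipartite G U V"
proof -
  interpret digraph G by fact
  interpret H: digraph "G \<restriction> (U \<union> V)"
    using assms by (intro digraphI_induced induced_induce) auto
  have "arcs_ends (G \<restriction> (U \<union> V)) = arcs_ends G \<inter> (U \<union> V) \<times> (U \<union> V)"
    by (auto simp: arcs_ends_conv)
  also have "\<dots> = U \<times> V \<union> V \<times> U"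
    using assms by (auto simp: independent_set_def all_edges_between_def)
  finally have ends: "arcs_ends (G \<restriction> (U \<union> V)) = U \<times> V \<union> V \<times> U" .
  then have "symmetric (G \<restriction> (U \<union> V))"
    by (auto simp: symmetric_def sym_def)
  then have "graph (G \<restriction> (U \<union> V))" by (rule H.graphI)
  then show ?thesis
    using assms(2-4) ends
    by (auto simp: induces_complete_bipartite_def complete_bipartite_digraph_def)
qed

text \<open>The field is forgotten here: adjacency of distinct vertices depends only on the sum of
  their class indices modulo \<open>m\<close>. The constant \<open>c\<close> starts as
  \<open>(q + 1) div 2\<close> and is later replaced by 0 or \<open>m div 2\<close>.\<close>

locale sum_graph = digraph G for G :: "('v, 'e) pre_digraph" +
  fixes Q :: "nat \<Rightarrow> 'v set" and m c :: nat
  assumes subset: "Q i \<subseteq> verts G"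
    and nonempty: "Q i \<noteq> {}"
    and inter_cong: "x \<in> Q i \<Longrightarrow> x \<in> Q j \<Longrightarrow> [i = j] (mod m)"
    and adj: "u \<in> Q i \<Longrightarrow> v \<in> Q j \<Longrightarrow> u \<rightarrow>\<^bsub>G\<^esub> v \<longleftrightarrow> u \<noteq> v \<and> [i + j = c] (mod m)"
begin

lemma sum_graph_cong:
  assumes "[c = c'] (mod m)"
  shows "sum_graph G Q m c'"
proof unfold_locales
  show "u \<rightarrow>\<^bsub>G\<^esub> v \<longleftrightarrow> u \<noteq> v \<and> [i + j = c'] (mod m)" if "u \<in> Q i" "v \<in> Q j" for u v i j
    using adj[OF that] assms cong_trans cong_sym by blast
qed (use subset nonempty inter_cong in auto)

text \<open>Incongruent indices give disjoint classes, so the condition \<open>u \<noteq> v\<close>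
  in \<open>adj\<close> holds automatically.\<close>

lemma all_edges_betweenI:
  assumes "[i + j = c] (mod m)" and "\<not> [i = j] (mod m)"
  shows "all_edges_between G (Q i) (Q j)"
  unfolding all_edges_between_def
  using adj[of _ i _ j] adj[of _ j _ i] assms inter_cong by (auto simp: add.commute)

lemma no_edges_betweenI:
  assumes "\<not> [i + j = c] (mod m)"
  shows "no_edges_between G (Q i) (Q j)"
  unfolding no_edges_between_def
  using adj[of _ i _ j] adj[of _ j _ i] assms by (auto simp: add.commute)

lemma edges_between:
  assumes "i < j" and "j \<le> m - 1"
  shows "if [i + j = c] (mod m) then all_edges_between G (Q i) (Q j)
         else no_edges_between G (Q i) (Q j)"
proof -
  have "\<not> [i = j] (mod m)" using assms by (auto simp: cong_def)
  then show ?thesis by (simp add: all_edges_betweenI no_edges_betweenI)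
qed

lemma cliqueI:
  assumes "[2 * i = c] (mod m)"
  shows "clique G (Q i)"
  unfolding clique_def using adj[of _ i _ i] assms subset by (auto simp: mult_2)

lemma independent_setI:
  assumes "\<not> [2 * i = c] (mod m)"
  shows "independent_set G (Q i)"
  unfolding independent_set_def using adj[of _ i _ i] assms subset by (auto simp: mult_2)

lemma induces_complete_bipartite:
  assumes "[i + j = c] (mod m)" and "i < j" and "j < m"
  shows "induces_complete_bipartite G (Q i) (Q j)"
proof (rule induces_complete_bipartiteI)
  have neq: "\<not> [i = j] (mod m)" using assms by (auto simp: cong_def)
  then show "Q i \<inter> Q j = {}" using inter_cong by blast
  show "all_edges_between G (Q i) (Q j)" using assms(1) neq by (rule all_edges_betweenI)
  \<comment> \<open>If \<open>i + i\<close> or \<open>j + j\<close> were congruent to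
    \<open>c\<close>, hence to \<open>i + j\<close>, cancelling the common summand would give
    \<open>i\<close> congruent to \<open>j\<close>.\<close>
  have "\<not> [i + i = c] (mod m)" "\<not> [j + j = c] (mod m)"
    using neq assms(1) by (metis cong_add_lcancel_nat cong_add_rcancel_nat cong_sym cong_trans)+
  then show "independent_set G (Q i)" "independent_set G (Q j)"
    by (auto intro: independent_setI simp flip: mult_2)
qed (auto simp: subset intro: digraph_axioms)

text \<open>The classes with index below \<open>m\<close> are nonempty and disjoint, so a union of
  two determines its indices, and \<open>i < j\<close> fixes their order. Counting different unions
  thus reduces to counting pairs.\<close>

lemma inj_on_union:
  assumes "\<And>i j. (i, j) \<in> P \<Longrightarrow> i < j \<and> j < m"
  shows "inj_on (\<lambda>(i, j). Q i \<union> Q j) P"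
proof (rule inj_onI, clarify)
  fix i j i' j'
  assume P: "(i, j) \<in> P" "(i', j') \<in> P" and eq: "Q i \<union> Q j = Q i' \<union> Q j'"
  have same: "x = y" if "z \<in> Q x" "z \<in> Q y" "x < m" "y < m" for x y z
    using inter_cong[OF that(1,2)] that(3,4) by (rule cong_less_modulus_unique_nat)
  obtain u v u' v' where "u \<in> Q i" "v \<in> Q j" "u' \<in> Q i'" "v' \<in> Q j'"
    using nonempty by (meson all_not_in_conv)
  then have "i = i' \<or> i = j'" "j = i' \<or> j = j'"
    using same eq assms[OF P(1)] assms[OF P(2)] by (metis Un_iff order.strict_trans)+
  then show "i = i' \<and> j = j'"
    using assms[OF P(1)] assms[OF P(2)] by auto
qed

lemma induce_complete_bipartite_graphs:
  assumes "\<And>i j. (i, j) \<in> P \<Longrightarrow> i < j \<and> j < m \<and> [i + j = c] (mod m)"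
    and "card P = n"
  shows "induce_complete_bipartite_graphs G Q P n"
proof -
  have "{Q i \<union> Q j |i j. (i, j) \<in> P} = (\<lambda>(i, j). Q i \<union> Q j) ` P" by auto
  then have "card {Q i \<union> Q j |i j. (i, j) \<in> P} = n"
    using card_image[OF inj_on_union, of P] assms by auto
  then show ?thesis
    using assms(1) by (auto simp: induce_complete_bipartite_graphs_def
        intro: induces_complete_bipartite)
qed

end

section \<open>Counting the index pairs\<close>

lemma card_graph_atLeastAtMost: "card {(f i, g i) |i. i \<in> {k..n}} = Suc n - k"
  if "inj f" for f :: "nat \<Rightarrow> nat"
proof -
  have "{(f i, g i) |i. i \<in> {k..n}} = (\<lambda>i. (f i, g i)) ` {k..n}" by auto
  moreover have "inj_on (\<lambda>i. (f i, g i)) {k..n}"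
    using that by (auto simp: inj_on_def)
  ultimately show ?thesis by (simp add: card_image)
qed

text \<open>First components are at most \<open>n < h\<close> in one family and above
  \<open>h\<close> in the other, so the sizes \<open>n + 1\<close> and \<open>n\<close> add up. In
  the application \<open>m = 2 * h\<close>, where \<open>i = 0\<close> in the second family would
  repeat the pair \<open>(0, h)\<close> modulo \<open>m\<close>.\<close>

lemma card_two_families:
  fixes h m n :: nat
  assumes "n < h"
  shows "card ({(i, h - i) |i. i \<in> {0..n}} \<union> {(h + i, m - i) |i. i \<in> {1..n}}) = 2 * n + 1"
proof -
  have "card ({(i, h - i) |i. i \<in> {0..n}} \<union> {(h + i, m - i) |i. i \<in> {1..n}})
      = card {(i, h - i) |i. i \<in> {0..n}} + card {(h + i, m - i) |i. i \<in> {1..n}}"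
    using assms by (intro card_Un_disjoint) auto
  also have "\<dots> = 2 * n + 1"
    using card_graph_atLeastAtMost[of "\<lambda>i. i" "\<lambda>i. h - i" 0 n]
      card_graph_atLeastAtMost[of "\<lambda>i. h + i" "\<lambda>i. m - i" 1 n] by simp
  finally show ?thesis .
qed

section \<open>The two cases, according to whether \<open>m\<close> divides
  \<open>(q + 1) div 2\<close>\<close>

theorem theorem4p1:
  fixes q m :: nat and \<beta> \<omega> :: "'a::{field,finite}"
    and QQ :: "'a set" and Q :: "nat \<Rightarrow> 'a set" and G :: "('a, 'a \<times> 'a) pre_digraph"
  assumes "primepow q" and "odd q" and "m \<ge> 2" and "m dvd q + 1"
    and "CARD('a) = q ^ 2" and "primitive_elem \<beta>"
  defines "\<omega> \<equiv> \<beta> ^ (q - 1)"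
  defines "QQ \<equiv> cyclic_subgroup \<omega>"
  defines "Q \<equiv> (\<lambda>i. (\<lambda>x. \<omega> ^ i * x) ` cyclic_subgroup (\<omega> ^ m))"
  defines "G \<equiv> gen_paley m \<restriction> QQ"
  shows
    "(m dvd (q + 1) div 2 \<longrightarrow>
        (\<forall>i\<^sub>1 i\<^sub>2. i\<^sub>1 < i\<^sub>2 \<and> i\<^sub>2 \<le> m - 1 \<longrightarrow>
           (if [i\<^sub>1 + i\<^sub>2 = 0] (mod m) then all_edges_between G (Q i\<^sub>1) (Q i\<^sub>2)
            else no_edges_between G (Q i\<^sub>1) (Q i\<^sub>2))) \<and>
        (odd m \<longrightarrow>
           clique G (Q 0) \<and>
           (\<forall>i\<in>{1..m - 1}. independent_set G (Q i)) \<and>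
           induce_complete_bipartite_graphs G Q
             {(i, m - i) | i. i \<in> {1..(m - 1) div 2}} ((m - 1) div 2)) \<and>
        (even m \<longrightarrow>
           clique G (Q 0) \<and> clique G (Q (m div 2)) \<and>
           (\<forall>i\<in>{1..m - 1} - {m div 2}. independent_set G (Q i)) \<and>
           (m \<ge> 4 \<longrightarrow>
              induce_complete_bipartite_graphs G Q
                {(i, m - i) | i. i \<in> {1..m div 2 - 1}} (m div 2 - 1)))) \<and>
     (\<not> m dvd (q + 1) div 2 \<longrightarrow>
        even m \<and>
        (\<forall>i\<^sub>1 i\<^sub>2. i\<^sub>1 < i\<^sub>2 \<and> i\<^sub>2 \<le> m - 1 \<longrightarrow>
           (if [i\<^sub>1 + i\<^sub>2 = m div 2] (mod m) then all_edges_between G (Q i\<^sub>1) (Q i\<^sub>2)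
            else no_edges_between G (Q i\<^sub>1) (Q i\<^sub>2))) \<and>
        (odd (m div 2) \<longrightarrow>
           (\<forall>i\<in>{0..m - 1}. independent_set G (Q i)) \<and>
           (m = 2 \<longrightarrow> QQ = Q 0 \<union> Q 1 \<and> induces_complete_bipartite G (Q 0) (Q 1)) \<and>
           (m \<ge> 6 \<longrightarrow>
              induce_complete_bipartite_graphs G Q
                ({(i, m div 2 - i) | i. i \<in> {0..(m - 2) div 4}} \<union>
                 {(m div 2 + i, m - i) | i. i \<in> {1..(m - 2) div 4}}) (m div 2))) \<and>
        (even (m div 2) \<longrightarrow>
           clique G (Q (m div 4)) \<and> clique G (Q (3 * m div 4)) \<and>
           (\<forall>i\<in>{0..m - 1} - {m div 4, 3 * m div 4}. independent_set G (Q i)) \<and>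
           (m = 4 \<longrightarrow> induces_complete_bipartite G (Q 0) (Q 2)) \<and>
           (m \<ge> 8 \<longrightarrow>
              induce_complete_bipartite_graphs G Q
                ({(i, m div 2 - i) | i. i \<in> {0..(m - 4) div 4}} \<union>
                 {(m div 2 + i, m - i) | i. i \<in> {1..(m - 4) div 4}}) ((m - 2) div 2))))"
proof -
  interpret P: paley_subgroup q m \<beta>
    using assms(1-6) by unfold_locales
  have \<omega>: "\<omega> = P.\<omega>" by (simp add: \<omega>_def P.\<omega>_def)
  have Q: "Q = P.coset" by (intro ext) (simp add: Q_def P.coset_def \<omega>)
  have G: "G = gen_paley m \<restriction> cyclic_subgroup P.\<omega>" by (simp add: G_def QQ_def \<omega>)
  have verts: "verts G = QQ" by (simp add: G_def)
  interpret S: sum_graph G Q m "(q + 1) div 2"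
  proof (rule sum_graph.intro)
    show "digraph G" unfolding G by (rule P.digraph_induced)
    show "sum_graph_axioms G Q m ((q + 1) div 2)"
      unfolding G Q
      by unfold_locales (use P.coset_subset P.coset_nonempty P.coset_inter_cong P.adjacent_iff in auto)
  qed
  show ?thesis
  proof (intro conjI[of "_ \<longrightarrow> _"] impI)
    assume "m dvd (q + 1) div 2"
    then interpret sum_graph G Q m 0
      by (intro S.sum_graph_cong) (simp add: cong_0_iff)
    \<comment> \<open>Each pair sums to \<open>m\<close>, and the bound on \<open>n\<close> gives
      \<open>i < m - i\<close>.\<close>
    have bipartite: "induce_complete_bipartite_graphs G Q {(i, m - i) |i. i \<in> {1..n}} n"
      if "2 * n < m" for n
      using that by (intro induce_complete_bipartite_graphs)
        (auto simp: cong_0_iff card_graph_atLeastAtMost[of "\<lambda>i. i", simplified])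
    \<comment> \<open>The only multiple of \<open>m\<close> strictly between 0 and
      \<open>2 * m\<close> is \<open>m\<close> itself.\<close>
    have not_cong: "\<not> [2 * i = 0] (mod m)" if "0 < i" "i < m" "2 * i \<noteq> m" for i
    proof
      assume "[2 * i = 0] (mod m)"
      then obtain k where k: "2 * i = m * k" by (auto simp: cong_0_iff)
      then have "m * 0 < m * k" "m * k < m * 2" using that k by linarith+
      then have "0 < k" "k < 2" by (simp_all only: mult_less_cancel1)
      then have "k = 1" by simp
      then show False using k that by simp
    qed
    show "(\<forall>i\<^sub>1 i\<^sub>2. i\<^sub>1 < i\<^sub>2 \<and> i\<^sub>2 \<le> m - 1 \<longrightarrow>
           (if [i\<^sub>1 + i\<^sub>2 = 0] (mod m) then all_edges_between G (Q i\<^sub>1) (Q i\<^sub>2)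
            else no_edges_between G (Q i\<^sub>1) (Q i\<^sub>2))) \<and>
        (odd m \<longrightarrow>
           clique G (Q 0) \<and>
           (\<forall>i\<in>{1..m - 1}. independent_set G (Q i)) \<and>
           induce_complete_bipartite_graphs G Q
             {(i, m - i) | i. i \<in> {1..(m - 1) div 2}} ((m - 1) div 2)) \<and>
        (even m \<longrightarrow>
           clique G (Q 0) \<and> clique G (Q (m div 2)) \<and>
           (\<forall>i\<in>{1..m - 1} - {m div 2}. independent_set G (Q i)) \<and>
           (m \<ge> 4 \<longrightarrow>
              induce_complete_bipartite_graphs G Q
                {(i, m - i) | i. i \<in> {1..m div 2 - 1}} (m div 2 - 1)))"
    proof (intro conjI allI impI ballI)
      fix i j assume "i < j \<and> j \<le> m - 1"
      then show "if [i + j = 0] (mod m) then all_edges_between G (Q i) (Q j)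
          else no_edges_between G (Q i) (Q j)"
        by (intro edges_between) auto
    next
      fix i assume "odd m" "i \<in> {1..m - 1}"
      then show "independent_set G (Q i)"
        by (intro independent_setI not_cong) auto
    next
      fix i assume "even m" "i \<in> {1..m - 1} - {m div 2}"
      then show "independent_set G (Q i)"
        by (intro independent_setI not_cong) auto
    next
      show "induce_complete_bipartite_graphs G Q
          {(i, m - i) |i. i \<in> {1..(m - 1) div 2}} ((m - 1) div 2)"
        using \<open>m \<ge> 2\<close> by (intro bipartite) linarith
      show "induce_complete_bipartite_graphs G Q
          {(i, m - i) |i. i \<in> {1..m div 2 - 1}} (m div 2 - 1)"
        using \<open>m \<ge> 2\<close> by (intro bipartite) linarith
    qed (auto intro: cliqueI simp: cong_0_iff)
  next
    assume not_dvd: "\<not> m dvd (q + 1) div 2"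
    obtain k where k: "q + 1 = m * k" using \<open>m dvd q + 1\<close> by blast
    have half: "2 * ((q + 1) div 2) = q + 1" using \<open>odd q\<close> by simp
    \<comment> \<open>An odd \<open>m\<close> is coprime to 2, so from \<open>q + 1\<close> it would
      divide the half as well.\<close>
    have "even m"
    proof (rule ccontr)
      assume "odd m"
      then have "coprime m 2" by simp
      moreover have "m dvd 2 * ((q + 1) div 2)" unfolding half by fact
      ultimately show False using not_dvd by (simp only: coprime_dvd_mult_right_iff)
    qed
    then obtain h where h: "m = 2 * h" by blast
    then have hk: "(q + 1) div 2 = h * k" using k by simp
    \<comment> \<open>For even \<open>k\<close> the product \<open>h * k\<close> would be a multiple
      of \<open>m = 2 * h\<close>. Hence \<open>(q + 1) div 2\<close> is an odd multiple of
      \<open>h\<close> and leaves remainder \<open>h\<close> modulo \<open>m\<close>.\<close>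
    then have "odd k" using not_dvd h by auto
    then obtain l where "k = 2 * l + 1" by (rule oddE)
    then have "(q + 1) div 2 = l * m + h" unfolding hk h by (simp add: algebra_simps)
    then interpret sum_graph G Q m h
      by (intro S.sum_graph_cong) (simp add: cong_def)
    have "h > 0" using \<open>m \<ge> 2\<close> h by simp
    \<comment> \<open>The sums are \<open>h\<close> in the first family and \<open>h + m\<close> in
      the second. The bound \<open>2 * n < h\<close> yields both \<open>i < h - i\<close> and
      \<open>h + i < m - i\<close>.\<close>
    have bipartite: "induce_complete_bipartite_graphs G Q
        ({(i, h - i) |i. i \<in> {0..n}} \<union> {(h + i, m - i) |i. i \<in> {1..n}}) (2 * n + 1)"
      if "2 * n < h" for n
    proof (rule induce_complete_bipartite_graphs)
      fix i j assume "(i, j) \<in> {(i, h - i) |i. i \<in> {0..n}} \<union> {(h + i, m - i) |i. i \<in> {1..n}}"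
      then show "i < j \<and> j < m \<and> [i + j = h] (mod m)"
        using that h by (auto simp: cong_def)
    qed (use that in \<open>intro card_two_families, simp\<close>)
    \<comment> \<open>Since \<open>2 * i < 2 * m\<close>, the only candidates are \<open>h\<close>
      and \<open>h + m = 3 * h\<close>.\<close>
    have cong_iff: "[2 * i = h] (mod m) \<longleftrightarrow> 2 * i = h \<or> 2 * i = 3 * h" if "i < m" for i
    proof
      assume "[2 * i = h] (mod m)"
      then have "2 * i mod m = h" using \<open>h > 0\<close> h by (simp add: cong_def)
      moreover have "2 * i mod m = 2 * i \<or> 2 * i mod m = 2 * i - m"
        using that by (cases "2 * i < m") (auto simp: le_mod_geq)
      ultimately show "2 * i = h \<or> 2 * i = 3 * h" using h \<open>h > 0\<close> by auto
    next
      assume "2 * i = h \<or> 2 * i = 3 * h"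
      then have "2 * i = h \<or> 2 * i = h + m" using h by linarith
      then show "[2 * i = h] (mod m)" by (auto simp: cong_def)
    qed
    \<comment> \<open>For odd \<open>h\<close> both \<open>h\<close> and \<open>3 * h\<close> are
      odd, so neither equals \<open>2 * i\<close>.\<close>
    have "\<not> [2 * i = h] (mod m)" if "i < m" "odd h" for i
      using cong_iff[OF that(1)] that(2) by presburger
    then have independent_odd: "independent_set G (Q i)" if "i \<le> m - 1" "odd h" for i
      using that \<open>m \<ge> 2\<close> by (intro independent_setI) auto
    show "even m \<and>
        (\<forall>i\<^sub>1 i\<^sub>2. i\<^sub>1 < i\<^sub>2 \<and> i\<^sub>2 \<le> m - 1 \<longrightarrow>
           (if [i\<^sub>1 + i\<^sub>2 = m div 2] (mod m) then all_edges_between G (Q i\<^sub>1) (Q i\<^sub>2)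
            else no_edges_between G (Q i\<^sub>1) (Q i\<^sub>2))) \<and>
        (odd (m div 2) \<longrightarrow>
           (\<forall>i\<in>{0..m - 1}. independent_set G (Q i)) \<and>
           (m = 2 \<longrightarrow> QQ = Q 0 \<union> Q 1 \<and> induces_complete_bipartite G (Q 0) (Q 1)) \<and>
           (m \<ge> 6 \<longrightarrow>
              induce_complete_bipartite_graphs G Q
                ({(i, m div 2 - i) | i. i \<in> {0..(m - 2) div 4}} \<union>
                 {(m div 2 + i, m - i) | i. i \<in> {1..(m - 2) div 4}}) (m div 2))) \<and>
        (even (m div 2) \<longrightarrow>
           clique G (Q (m div 4)) \<and> clique G (Q (3 * m div 4)) \<and>
           (\<forall>i\<in>{0..m - 1} - {m div 4, 3 * m div 4}. independent_set G (Q i)) \<and>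
           (m = 4 \<longrightarrow> induces_complete_bipartite G (Q 0) (Q 2)) \<and>
           (m \<ge> 8 \<longrightarrow>
              induce_complete_bipartite_graphs G Q
                ({(i, m div 2 - i) | i. i \<in> {0..(m - 4) div 4}} \<union>
                 {(m div 2 + i, m - i) | i. i \<in> {1..(m - 4) div 4}}) ((m - 2) div 2)))"
    proof -
      have div2: "m div 2 = h" using h by simp
      have odd_case: "(\<forall>i\<in>{0..m - 1}. independent_set G (Q i)) \<and>
           (m = 2 \<longrightarrow> QQ = Q 0 \<union> Q 1 \<and> induces_complete_bipartite G (Q 0) (Q 1)) \<and>
           (m \<ge> 6 \<longrightarrow>
              induce_complete_bipartite_graphs G Q
                ({(i, h - i) | i. i \<in> {0..(m - 2) div 4}} \<union>
                 {(h + i, m - i) | i. i \<in> {1..(m - 2) div 4}}) h)" if "odd h"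
      proof (intro conjI impI)
        assume "m = 2"
        show "QQ = Q 0 \<union> Q 1"
        proof
          have "[a = 0] (mod m) \<or> [a = 1] (mod m)" for a
            unfolding \<open>m = 2\<close> cong_def by auto
          then show "QQ \<subseteq> Q 0 \<union> Q 1"
            unfolding QQ_def \<omega> P.cyclic_subgroup_omega Q P.coset_eq by auto
          show "Q 0 \<union> Q 1 \<subseteq> QQ" using subset verts by auto
        qed
        show "induces_complete_bipartite G (Q 0) (Q 1)"
          using \<open>m = 2\<close> h by (intro induces_complete_bipartite) auto
      next
        \<comment> \<open>With this \<open>n\<close> the two families together have
          \<open>2 * n + 1 = h\<close> pairs.\<close>
        obtain n where n: "h = 2 * n + 1" using \<open>odd h\<close> by (rule oddE)
        then have "(m - 2) div 4 = n" using h by simp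
        then show "induce_complete_bipartite_graphs G Q
            ({(i, h - i) | i. i \<in> {0..(m - 2) div 4}} \<union>
             {(h + i, m - i) | i. i \<in> {1..(m - 2) div 4}}) h"
          using bipartite[of n] n by simp
      qed (use independent_odd \<open>odd h\<close> in auto)
      have even_case: "clique G (Q (m div 4)) \<and> clique G (Q (3 * m div 4)) \<and>
           (\<forall>i\<in>{0..m - 1} - {m div 4, 3 * m div 4}. independent_set G (Q i)) \<and>
           (m = 4 \<longrightarrow> induces_complete_bipartite G (Q 0) (Q 2)) \<and>
           (m \<ge> 8 \<longrightarrow>
              induce_complete_bipartite_graphs G Q
                ({(i, h - i) | i. i \<in> {0..(m - 4) div 4}} \<union>
                 {(h + i, m - i) | i. i \<in> {1..(m - 4) div 4}}) ((m - 2) div 2))" if "even h"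
      proof -
        \<comment> \<open>The solutions of \<open>2 * i = h\<close> and \<open>2 * i = 3 * h\<close>
          are now \<open>n\<close> and \<open>3 * n\<close>, the indices of the two cliques.\<close>
        obtain n where n: "h = 2 * n" using \<open>even h\<close> by blast
        then have m: "m = 4 * n" "m div 4 = n" "3 * m div 4 = 3 * n" "(m - 4) div 4 = n - 1" "n > 0"
          using h \<open>h > 0\<close> by auto
        show ?thesis
          unfolding m(2-4)
        proof (intro conjI impI ballI)
          show "clique G (Q n)" "clique G (Q (3 * n))"
            using cong_iff[of n] cong_iff[of "3 * n"] m n by (auto intro: cliqueI)
          show "independent_set G (Q i)" if "i \<in> {0..m - 1} - {n, 3 * n}" for i
          proof (rule independent_setI)
            have "i < m" using that m(1,5) by auto
            then show "\<not> [2 * i = h] (mod m)" using that cong_iff[of i] n by auto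
          qed
          show "induces_complete_bipartite G (Q 0) (Q 2)" if "m = 4"
            using that h by (intro induces_complete_bipartite) (auto simp: cong_def)
          \<comment> \<open>The families stop at \<open>n - 1\<close>, because \<open>i = n\<close>
            would pair a clique with itself: \<open>h - n = n\<close> and
            \<open>h + n = m - n\<close>.\<close>
          have "(m - 2) div 2 = 2 * (n - 1) + 1" using m by (simp add: algebra_simps)
          then show "induce_complete_bipartite_graphs G Q
              ({(i, h - i) | i. i \<in> {0..n - 1}} \<union>
               {(h + i, m - i) | i. i \<in> {1..n - 1}}) ((m - 2) div 2)"
            using bipartite[of "n - 1"] n m(5) by simp
        qed
      qed
      show ?thesis
        unfolding div2 using \<open>even m\<close> edges_between odd_case even_case by blast
    qed
  qed
qed

end
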